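(* Let $c>1$ satisfy $\sum_{x\ge1}\sum_{y\ge1}(x y+1)^{-c}>1$. Then $u(n)=\Omega(n^c)$; that is, there exists a constant $a>0$ with $u(n)\ge a\,n^c$ for all positive integers $n$. Here $u(n)$ denotes the minimum number of leaves of a rooted tree that contains, as a topological minor, every rooted tree with $n$ leaves and no degree-1 nodes.
   Context: Trees are rooted and unordered, with edges directed from parent to child. The degree of a node is its number of children; a degree-1 node has exactly one child. $T'$ is a topological minor of $T$ if there is an injective map $f$ from the nodes of $T'$ to the nodes of $T$ with $f(\mathsf{NCA}(u,v))=\mathsf{NCA}(f(u),f(v))$ for all $u,v$. Equivalently, $T$ contains a subdivision of $T'$ as a subgraph. $\mathsf{NCA}$ denotes the nearest common ancestor. *)

theory Defs
  imports Complex_Main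
begin

text \<open>Rooted trees. A tree is represented by a (plane) datatype; the order of children
  is irrelevant for all notions below (topological minors are defined via injective
  node maps), so the datatype faithfully represents rooted unordered trees.
  Nodes of a tree are identified with their positions (paths of child indices from the root).\<close>

datatype rtree = Node "rtree list"

fun children :: "rtree \<Rightarrow> rtree list" where
  "children (Node ts) = ts"

fun valid_pos :: "rtree \<Rightarrow> nat list \<Rightarrow> bool" where
  "valid_pos t [] = True"
| "valid_pos (Node ts) (i # p) = (i < length ts \<and> valid_pos (ts ! i) p)"

fun subtree :: "rtree \<Rightarrow> nat list \<Rightarrow> rtree" where
  "subtree t [] = t"
| "subtree (Node ts) (i # p) = subtree (ts ! i) p"

definition nodes :: "rtree \<Rightarrow> nat list set" where
  "nodes t = {p. valid_pos t p}"

definition degree :: "rtree \<Rightarrow> nat list \<Rightarrow> nat" where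
  "degree t p = length (children (subtree t p))"

definition leaves :: "rtree \<Rightarrow> nat list set" where
  "leaves t = {p \<in> nodes t. degree t p = 0}"

definition num_leaves :: "rtree \<Rightarrow> nat" where
  "num_leaves t = card (leaves t)"

definition no_degree_one :: "rtree \<Rightarrow> bool" where
  "no_degree_one t \<longleftrightarrow> (\<forall>p \<in> nodes t. degree t p \<noteq> 1)"

text \<open>Nearest common ancestor of two nodes = longest common prefix of their positions.\<close>
fun nca :: "nat list \<Rightarrow> nat list \<Rightarrow> nat list" where
  "nca (x # xs) (y # ys) = (if x = y then x # nca xs ys else [])"
| "nca _ _ = []"

definition top_minor :: "rtree \<Rightarrow> rtree \<Rightarrow> bool" where
  "top_minor T' T \<longleftrightarrow> (\<exists>f. inj_on f (nodes T') \<and> f ` nodes T' \<subseteq> nodes T \<and>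
      (\<forall>u \<in> nodes T'. \<forall>v \<in> nodes T'. f (nca u v) = nca (f u) (f v)))"

definition univ_leaves :: "nat \<Rightarrow> nat" where
  "univ_leaves n = (LEAST k. \<exists>T. num_leaves T = k \<and>
      (\<forall>T'. num_leaves T' = n \<and> no_degree_one T' \<longrightarrow> top_minor T' T))"

end

theory Submission
  imports Defs "HOL-Analysis.Summation_Tests"
begin

text \<open>
  For a tree \<open>B\<close>, let \<open>T\<^sub>B\<close> consist of the nodes of \<open>T\<close> whose subtrees contain \<open>B\<close>, and let
  \<open>\<ell>(B)\<close> be its number of leaves. Let \<open>C(x,y,B)\<close> be the caterpillar with \<open>x\<close> spine nodes in which
  \<open>y\<close> copies of \<open>B\<close> hang from each spine node and one more copy ends the spine; it has \<open>x y + 1\<close>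
  times as many leaves as \<open>B\<close>. A node of \<open>T\<close> whose subtree contains \<open>C(x,y,B)\<close> starts a path with
  at least \<open>x\<close> nodes of degree more than \<open>y\<close> in \<open>T\<^sub>B\<close>. The lowest nodes with this property have
  degree more than \<open>y\<close> and exactly \<open>x\<close> such nodes on the best path below, so for fixed \<open>y\<close> they are
  distinct for distinct \<open>x\<close>, and the sum over all \<open>x\<close> and \<open>y\<close> of \<open>\<ell>(C(x,y,B))\<close> is at most the sum
  of \<open>degree - 1\<close> over the inner nodes of \<open>T\<^sub>B\<close>, which is less than \<open>\<ell>(B)\<close>. Since the weights
  \<open>(x y + 1) powr (- c)\<close> have a finite partial sum exceeding 1, some bounded \<open>x\<close> and \<open>y\<close> satisfy
  \<open>\<ell>(C(x,y,B)) \<le> (x y + 1) powr (- c) * \<ell>(B)\<close>. Iterating from a single leaf gives trees \<open>B\<close> whose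
  sizes grow by bounded factors with \<open>\<ell>(B) * num_leaves B powr c \<le> num_leaves T\<close>; if \<open>T\<close> is
  universal for \<open>n\<close>, then \<open>\<ell>(B) \<ge> 1\<close> as long as \<open>B\<close> has at most \<open>n\<close> leaves.
\<close>

section \<open>Nodes and leaves of rooted trees\<close>

lemma nodes_Node: "nodes (Node ts) = insert [] (\<Union>i<length ts. Cons i ` nodes (ts ! i))"
proof (rule set_eqI)
  fix p show "p \<in> nodes (Node ts) \<longleftrightarrow> p \<in> insert [] (\<Union>i<length ts. Cons i ` nodes (ts ! i))"
    by (cases p) (auto simp: nodes_def)
qed

lemma Nil_in_nodes [simp]: "[] \<in> nodes t"
  by (simp add: nodes_def)

lemma Cons_in_nodes [simp]: "i # p \<in> nodes (Node ts) \<longleftrightarrow> i < length ts \<and> p \<in> nodes (ts ! i)"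
  by (simp add: nodes_def)

lemma degree_Nil [simp]: "degree (Node ts) [] = length ts"
  and degree_Cons [simp]: "degree (Node ts) (i # p) = degree (ts ! i) p"
  by (simp_all add: degree_def)

lemma finite_nodes [simp]: "finite (nodes t)"
  by (induction t) (auto simp: nodes_Node)

lemma leaves_Node:
  "leaves (Node ts) = (if ts = [] then {[]} else (\<Union>i<length ts. Cons i ` leaves (ts ! i)))"
  by (auto simp: leaves_def nodes_Node)

lemma num_leaves_Node:
  "num_leaves (Node ts) = (if ts = [] then 1 else (\<Sum>t\<leftarrow>ts. num_leaves t))"
proof -
  have "card (\<Union>i<length ts. Cons i ` leaves (ts ! i)) = (\<Sum>i<length ts. card (Cons i ` leaves (ts ! i)))"
    by (rule card_UN_disjoint) (auto simp: leaves_def)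
  also have "\<dots> = (\<Sum>i<length ts. num_leaves (ts ! i))"
    by (simp add: card_image num_leaves_def)
  also have "\<dots> = (\<Sum>t\<leftarrow>ts. num_leaves t)"
    by (simp add: sum_list_sum_nth atLeast0LessThan)
  finally show ?thesis
    by (simp add: num_leaves_def leaves_Node)
qed

lemma length_le_sum_list:
  fixes f :: "'a \<Rightarrow> nat"
  assumes "\<And>x. x \<in> set xs \<Longrightarrow> 1 \<le> f x"
  shows "length xs \<le> (\<Sum>x\<leftarrow>xs. f x)"
  using sum_list_mono[of xs "\<lambda>_. 1" f] assms by (simp add: sum_list_triv)

lemma num_leaves_pos: "1 \<le> num_leaves t"
proof (induction t)
  case (Node ts)
  show ?case
  proof (cases ts)
    case (Cons t us)
    then have "1 \<le> length ts" by simp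
    also have "\<dots> \<le> (\<Sum>t\<leftarrow>ts. num_leaves t)"
      using Node by (intro length_le_sum_list) auto
    finally show ?thesis using Cons by (simp add: num_leaves_Node)
  qed (simp add: num_leaves_Node)
qed

lemma no_degree_one_Node:
  "no_degree_one (Node ts) \<longleftrightarrow> length ts \<noteq> 1 \<and> (\<forall>t\<in>set ts. no_degree_one t)"
  by (auto simp: no_degree_one_def nodes_Node all_set_conv_all_nth)

section \<open>Existence of a universal tree\<close>

fun full_tree :: "nat \<Rightarrow> nat \<Rightarrow> rtree" where
  "full_tree d 0 = Node []"
| "full_tree d (Suc h) = Node (replicate d (full_tree d h))"

lemma nodes_full_tree: "length p \<le> h \<Longrightarrow> \<forall>i\<in>set p. i < d \<Longrightarrow> p \<in> nodes (full_tree d h)"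
proof (induction d h arbitrary: p rule: full_tree.induct)
  case (2 d h)
  then show ?case by (cases p) auto
qed simp

text \<open>Every sibling of the chosen child holds a leaf, so a step down loses at least
  \<open>length ts - 1 \<ge> 1\<close> leaves. This bounds both depth and child indices.\<close>

lemma nodes_bounded:
  assumes "no_degree_one t" "p \<in> nodes t"
  shows "length p < num_leaves t \<and> (\<forall>i\<in>set p. i < num_leaves t)"
  using assms
proof (induction t arbitrary: p)
  case (Node ts)
  show ?case
  proof (cases p)
    case Nil
    then show ?thesis using num_leaves_pos[of "Node ts"] by simp
  next
    case (Cons i q)
    with Node.prems have i: "i < length ts" "q \<in> nodes (ts ! i)" by auto
    with Node.prems have len: "length ts \<ge> 2" by (auto simp: no_degree_one_Node)
    have IH: "length q < num_leaves (ts ! i)" "\<forall>j\<in>set q. j < num_leaves (ts ! i)"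
      using Node i by (auto simp: no_degree_one_Node)
    have "num_leaves (ts ! i) + (length ts - 1)
        \<le> num_leaves (ts ! i) + (\<Sum>j\<in>{..<length ts} - {i}. num_leaves (ts ! j))"
      using i sum_mono[of "{..<length ts} - {i}" "\<lambda>_. 1" "\<lambda>j. num_leaves (ts ! j)"] num_leaves_pos
      by (simp del: One_nat_def)
    also have "\<dots> = num_leaves (Node ts)"
      using i len by (auto simp: num_leaves_Node sum_list_sum_nth atLeast0LessThan
        sum.remove[of "{..<length ts}" i])
    finally have *: "num_leaves (ts ! i) + (length ts - 1) \<le> num_leaves (Node ts)" .
    moreover have "1 \<le> num_leaves (ts ! i)" by (rule num_leaves_pos)
    ultimately have "i < num_leaves (Node ts)" "Suc (length q) < num_leaves (Node ts)"
      "num_leaves (ts ! i) \<le> num_leaves (Node ts)"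
      using i IH len by linarith+
    then show ?thesis using Cons IH by force
  qed
qed

lemma top_minor_full_tree:
  assumes "no_degree_one t"
  shows "top_minor t (full_tree (num_leaves t) (num_leaves t))"
  unfolding top_minor_def
proof (intro exI[of _ id] conjI)
  show "id ` nodes t \<subseteq> nodes (full_tree (num_leaves t) (num_leaves t))"
    using nodes_bounded[OF assms] nodes_full_tree by (simp add: subset_iff less_imp_le)
qed simp_all

text \<open>\<open>LEAST\<close> is meaningful only if some value qualifies;
  \<open>full_tree n n\<close> supplies one.\<close>

lemma univ_leaves_attained:
  obtains T where "num_leaves T = univ_leaves n"
    "\<And>t. num_leaves t = n \<Longrightarrow> no_degree_one t \<Longrightarrow> top_minor t T"
proof -
  have "\<exists>k T. num_leaves T = k \<and> (\<forall>t. num_leaves t = n \<and> no_degree_one t \<longrightarrow> top_minor t T)"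
  proof (intro exI conjI allI impI)
    show "num_leaves (full_tree n n) = num_leaves (full_tree n n)" ..
    show "top_minor t (full_tree n n)" if "num_leaves t = n \<and> no_degree_one t" for t
      using top_minor_full_tree[of t] that by simp
  qed
  from LeastI_ex[OF this] obtain T where "num_leaves T = univ_leaves n"
    "\<forall>t. num_leaves t = n \<and> no_degree_one t \<longrightarrow> top_minor t T"
    unfolding univ_leaves_def by (elim exE conjE)
  then show thesis using that by simp
qed

section \<open>Topological minors in recursive form\<close>

inductive minor :: "rtree \<Rightarrow> rtree \<Rightarrow> bool" where
  minor_child: "t \<in> set ts \<Longrightarrow> minor s t \<Longrightarrow> minor s (Node ts)"
| minor_node: "inj_on \<sigma> {..<length ss} \<Longrightarrow> (\<And>i. i < length ss \<Longrightarrow> \<sigma> i < length ts) \<Longrightarrow>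
    (\<And>i. i < length ss \<Longrightarrow> minor (ss ! i) (ts ! \<sigma> i)) \<Longrightarrow> minor (Node ss) (Node ts)"

lemma nca_Nil [simp]: "nca [] q = []" "nca p [] = []"
  by (simp, cases p) auto

text \<open>Preserving \<open>nca\<close> makes \<open>f []\<close> a prefix of every image. If
  \<open>f []\<close> is not the root, all images lie in one child subtree; otherwise distinct
  children of the root, whose \<open>nca\<close> is the root, go into distinct child
  subtrees.\<close>

lemma top_minor_imp_minor: "top_minor s t \<Longrightarrow> minor s t"
proof (induction t arbitrary: s)
  case (Node ts)
  obtain ss where s: "s = Node ss" by (cases s)
  from Node.prems obtain f where inj: "inj_on f (nodes s)" and sub: "f ` nodes s \<subseteq> nodes (Node ts)"
    and nca: "\<And>u v. u \<in> nodes s \<Longrightarrow> v \<in> nodes s \<Longrightarrow> f (nca u v) = nca (f u) (f v)"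
    unfolding top_minor_def by blast
  \<comment> \<open>Images sharing the first index \<open>j\<close> embed into \<open>ts ! j\<close>
    once it is dropped. The map \<open>g\<close> will be \<open>id\<close> for all of
    \<open>s\<close> and \<open>Cons i\<close> for its \<open>i\<close>-th child.\<close>
  have tl_minor: "top_minor s' (ts ! j)"
    if j: "\<And>p. p \<in> nodes s' \<Longrightarrow> g p \<in> nodes s \<and> (\<exists>q. f (g p) = j # q)"
      and g: "inj g" "\<And>u v. g (nca u v) = nca (g u) (g v)" for s' j g
    unfolding top_minor_def
  proof (intro exI[of _ "\<lambda>p. tl (f (g p))"] conjI ballI)
    have eq: "f (g p) = j # tl (f (g p))" if "p \<in> nodes s'" for p
      using j[OF that] by auto
    show "inj_on (\<lambda>p. tl (f (g p))) (nodes s')"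
    proof (rule inj_onI)
      fix p q assume *: "p \<in> nodes s'" "q \<in> nodes s'" "tl (f (g p)) = tl (f (g q))"
      then have "f (g p) = f (g q)" using eq by metis
      then show "p = q" using * j inj g(1) by (meson inj_onD injD)
    qed
    show "(\<lambda>p. tl (f (g p))) ` nodes s' \<subseteq> nodes (ts ! j)"
    proof safe
      fix p assume p: "p \<in> nodes s'"
      with j sub have "f (g p) \<in> nodes (Node ts)" by blast
      then show "tl (f (g p)) \<in> nodes (ts ! j)"
        using eq[OF p] by (metis Cons_in_nodes)
    qed
    fix u v assume uv: "u \<in> nodes s'" "v \<in> nodes s'"
    have "f (g (nca u v)) = nca (f (g u)) (f (g v))"
      using uv j nca g(2) by auto
    also have "\<dots> = nca (j # tl (f (g u))) (j # tl (f (g v)))"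
      using eq uv by metis
    finally show "tl (f (g (nca u v))) = nca (tl (f (g u))) (tl (f (g v)))" by simp
  qed
  show ?case
  proof (cases "f []")
    case (Cons j q)
    have "j # q \<in> nodes (Node ts)" using sub Cons by (metis Nil_in_nodes image_subset_iff)
    then have "ts ! j \<in> set ts" by simp
    moreover have "top_minor s (ts ! j)"
    proof (rule tl_minor[where g = id])
      fix p assume p: "p \<in> nodes s"
      from nca[OF Nil_in_nodes p] Cons have "j # q = nca (j # q) (f p)" by simp
      then have "\<exists>q. f p = j # q" by (cases "f p") (auto split: if_splits)
      then show "id p \<in> nodes s \<and> (\<exists>q. f (id p) = j # q)" using p by simp
    qed auto
    ultimately show ?thesis using Node.IH minor_child by blast
  next
    case Nil
    have child: "\<exists>j q. f [i] = j # q" if "i < length ss" for i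
    proof -
      have "[i] \<in> nodes s" using that s by simp
      then have "f [i] \<noteq> f []" using inj by (auto dest: inj_onD)
      then show ?thesis using Nil by (cases "f [i]") auto
    qed
    define \<sigma> where "\<sigma> i = hd (f [i])" for i
    have \<sigma>: "\<exists>q. f [i] = \<sigma> i # q" if "i < length ss" for i
      using child[OF that] by (auto simp: \<sigma>_def)
    have lt: "\<sigma> i < length ts" if i: "i < length ss" for i
    proof -
      have "f [i] \<in> nodes (Node ts)" using sub i s by auto
      then show ?thesis using \<sigma>[OF i] by auto
    qed
    have "inj_on \<sigma> {..<length ss}"
    proof (rule inj_onI, rule ccontr)
      fix i j assume ij: "i \<in> {..<length ss}" "j \<in> {..<length ss}" "\<sigma> i = \<sigma> j" "i \<noteq> j"
      then have "nca (f [i]) (f [j]) = f []" using nca[of "[i]" "[j]"] s by simp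
      then show False using \<sigma>[of i] \<sigma>[of j] ij Nil by auto
    qed
    moreover have "minor (ss ! i) (ts ! \<sigma> i)" if i: "i < length ss" for i
    proof -
      have "top_minor (ss ! i) (ts ! \<sigma> i)"
      proof (rule tl_minor[where g = "Cons i"])
        fix p assume p: "p \<in> nodes (ss ! i)"
        then have "f [i] = nca (f [i]) (f (i # p))"
          using nca[of "[i]" "i # p"] i s by simp
        then have "\<exists>q. f (i # p) = \<sigma> i # q"
          using \<sigma>[OF i] by (cases "f (i # p)") (auto split: if_splits)
        then show "i # p \<in> nodes s \<and> (\<exists>q. f (i # p) = \<sigma> i # q)" using p i s by simp
      qed auto
      then show ?thesis using Node.IH lt[OF i] by simp
    qed
    ultimately show ?thesis using lt s by (auto intro: minor_node)
  qed
qed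

lemma minor_leaf [simp]: "minor (Node []) t"
  by (cases t) (auto intro: minor_node[where \<sigma> = id])

lemma minor_subtree: "minor (Node ss) t \<Longrightarrow> s \<in> set ss \<Longrightarrow> minor s t"
proof (induction "Node ss" t rule: minor.induct)
  case (minor_node \<sigma> ts)
  then obtain i where "i < length ss" "s = ss ! i" by (auto simp: in_set_conv_nth)
  then show ?case using minor_node by (auto intro!: minor_child[of "ts ! \<sigma> i"])
qed (auto intro: minor_child)

section \<open>Pruned trees and counting of branching nodes\<close>

text \<open>For a predicate inherited by ancestors, the number of leaves of the tree formed by the nodes
  whose subtrees satisfy it, which is also the largest number of disjoint such subtrees.\<close>
fun pruned_leaves :: "(rtree \<Rightarrow> bool) \<Rightarrow> rtree \<Rightarrow> nat" where
  "pruned_leaves Q (Node ts) =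
    (if Q (Node ts) then max 1 (\<Sum>t\<leftarrow>ts. pruned_leaves Q t) else 0)"

lemma pruned_leaves_pos: "Q t \<Longrightarrow> 1 \<le> pruned_leaves Q t"
  by (cases t) auto

lemma pruned_leaves_eq_0: "\<not> Q t \<Longrightarrow> pruned_leaves Q t = 0"
  by (cases t) auto

lemma pruned_leaves_mono:
  assumes "\<And>t. P t \<Longrightarrow> Q t"
  shows "pruned_leaves P t \<le> pruned_leaves Q t"
proof (induction t)
  case (Node ts)
  have "(\<Sum>t\<leftarrow>ts. pruned_leaves P t) \<le> (\<Sum>t\<leftarrow>ts. pruned_leaves Q t)"
    using Node by (intro sum_list_mono) auto
  then show ?case using assms by (auto simp: max_def)
qed

lemma pruned_leaves_True: "pruned_leaves (\<lambda>_. True) t = num_leaves t"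
proof (induction t)
  case (Node ts)
  then have "map (pruned_leaves (\<lambda>_. True)) ts = map num_leaves ts"
    by (intro map_cong) auto
  then show ?case using num_leaves_pos[of "Node ts"] 
    by (auto simp: num_leaves_Node simp del: map_eq_conv)
qed

text \<open>The largest number of nodes with more than \<open>y\<close> children satisfying
  \<open>Q\<close> on one downward path.\<close>

fun spine_rank :: "(rtree \<Rightarrow> bool) \<Rightarrow> nat \<Rightarrow> rtree \<Rightarrow> nat" where
  "spine_rank Q y (Node ts) =
    Max (insert 0 (spine_rank Q y ` set ts)) + (if y < length (filter Q ts) then 1 else 0)"

text \<open>Over all \<open>y \<ge> 1\<close>, a node with \<open>d \<ge> 1\<close> children
  satisfying \<open>Q\<close> is counted \<open>d - 1\<close> times in total.\<close>

fun branchings :: "(rtree \<Rightarrow> bool) \<Rightarrow> nat \<Rightarrow> rtree \<Rightarrow> nat" where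
  "branchings Q y (Node ts) =
    (\<Sum>t\<leftarrow>ts. branchings Q y t) + (if y < length (filter Q ts) then 1 else 0)"

text \<open>A node is a leaf of the tree pruned by \<open>x \<le> spine_rank Q y\<close> exactly if it has more than
  \<open>y\<close> children satisfying \<open>Q\<close> and its rank is \<open>x\<close>. So every such node is counted for only
  one \<open>x\<close>.\<close>
lemma pruned_leaves_rank:
  assumes "1 \<le> x"
  shows "pruned_leaves (\<lambda>t. x \<le> spine_rank Q y t) (Node ts) =
    (\<Sum>t\<leftarrow>ts. pruned_leaves (\<lambda>t. x \<le> spine_rank Q y t) t) +
    (if y < length (filter Q ts) \<and> spine_rank Q y (Node ts) = x then 1 else 0)"
proof -
  let ?P = "\<lambda>t. x \<le> spine_rank Q y t"
  let ?M = "Max (insert 0 (spine_rank Q y ` set ts))"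
  \<comment> \<open>As \<open>1 \<le> x\<close>, the inserted 0 cannot reach
    \<open>x\<close>.\<close>
  have M: "x \<le> ?M \<longleftrightarrow> (\<exists>t\<in>set ts. ?P t)"
    using assms by (subst Max_ge_iff) auto
  show ?thesis
  proof (cases "x \<le> ?M")
    \<comment> \<open>The children's sum is positive, so \<open>max 1\<close> changes nothing, and a
      root with more than \<open>y\<close> good children has rank above \<open>x\<close>.\<close>
    case True
    then obtain t where t: "t \<in> set ts" "?P t" using M by blast
    have "1 \<le> pruned_leaves ?P t" using t by (intro pruned_leaves_pos) simp
    also have "\<dots> \<le> (\<Sum>t\<leftarrow>ts. pruned_leaves ?P t)"
      using t by (intro member_le_sum_list) auto
    finally show ?thesis using True by auto
  next
    \<comment> \<open>The root can reach \<open>x\<close> only through its own increment, hence with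
      rank exactly \<open>x\<close>.\<close>
    case False
    then have "\<forall>t\<in>set ts. pruned_leaves ?P t = 0"
      using M pruned_leaves_eq_0[of ?P] by blast
    then have "(\<Sum>t\<leftarrow>ts. pruned_leaves ?P t) = 0" by (simp add: sum_list_eq_0_iff)
    then show ?thesis using False by auto
  qed
qed

lemma sum_pruned_leaves_rank:
  "(\<Sum>x<m. pruned_leaves (\<lambda>t. Suc x \<le> spine_rank Q y t) t) \<le> branchings Q y t"
proof (induction t)
  case (Node ts)
  let ?p = "\<lambda>x. pruned_leaves (\<lambda>t. Suc x \<le> spine_rank Q y t)"
  let ?b = "\<lambda>x. if y < length (filter Q ts) \<and> spine_rank Q y (Node ts) = Suc x then 1 else (0::nat)"
  have "(\<Sum>x<m. ?p x (Node ts)) = (\<Sum>x<m. \<Sum>t\<leftarrow>ts. ?p x t) + (\<Sum>x<m. ?b x)"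
    by (subst sum.distrib[symmetric], rule sum.cong[OF refl], rule pruned_leaves_rank) simp
  also have "(\<Sum>x<m. \<Sum>t\<leftarrow>ts. ?p x t) = (\<Sum>t\<leftarrow>ts. \<Sum>x<m. ?p x t)"
    by (induction ts) (simp_all add: sum.distrib)
  also have "\<dots> \<le> (\<Sum>t\<leftarrow>ts. branchings Q y t)"
    using Node by (intro sum_list_mono) auto
  also have "(\<Sum>x<m. ?b x) \<le> (\<Sum>x<m. if x = spine_rank Q y (Node ts) - 1
      then (if y < length (filter Q ts) then 1 else 0) else 0)"
    by (intro sum_mono) auto
  also have "\<dots> \<le> (if y < length (filter Q ts) then 1 else 0)"
    by (subst sum.delta) auto
  finally show ?case by simp
qed

lemma branchings_eq_0:
  assumes up: "\<And>t ts. t \<in> set ts \<Longrightarrow> Q t \<Longrightarrow> Q (Node ts)"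
  shows "\<not> Q t \<Longrightarrow> branchings Q y t = 0"
proof (induction t)
  case (Node ts)
  then have none: "\<forall>t\<in>set ts. \<not> Q t" using up by blast
  then have "filter Q ts = []" by (simp add: filter_empty_conv)
  then show ?case using Node none by (auto simp: sum_list_eq_0_iff)
qed

text \<open>In a tree, the number of leaves exceeds the sum of \<open>degree - 1\<close> over the inner nodes
  by one.\<close>
lemma sum_branchings:
  assumes up: "\<And>t ts. t \<in> set ts \<Longrightarrow> Q t \<Longrightarrow> Q (Node ts)"
  shows "(\<Sum>y<m. branchings Q (Suc y) t) + (if Q t then 1 else 0) \<le> pruned_leaves Q t"
proof (induction t)
  case (Node ts)
  show ?case
  proof (cases "Q (Node ts)")
    case True
    let ?d = "length (filter Q ts)"
    have d: "?d = (\<Sum>t\<leftarrow>ts. if Q t then 1 else 0)"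
      by (induction ts) auto
    have "(\<Sum>y<m. branchings Q (Suc y) (Node ts)) =
        (\<Sum>y<m. \<Sum>t\<leftarrow>ts. branchings Q (Suc y) t) + (\<Sum>y<m. if Suc y < ?d then 1 else 0)"
      by (simp add: sum.distrib)
    also have "(\<Sum>y<m. \<Sum>t\<leftarrow>ts. branchings Q (Suc y) t) =
        (\<Sum>t\<leftarrow>ts. \<Sum>y<m. branchings Q (Suc y) t)"
      by (induction ts) (simp_all add: sum.distrib)
    also have "(\<Sum>y<m. if Suc y < ?d then 1 else 0) = card {y. y < m \<and> Suc y < ?d}"
      by (simp add: sum.If_cases Int_def)
    also have "\<dots> \<le> card {..<?d - 1}"
      by (intro card_mono) auto
    also have "\<dots> = ?d - 1" by simp
    finally have "(\<Sum>y<m. branchings Q (Suc y) (Node ts)) \<le>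
      (\<Sum>t\<leftarrow>ts. \<Sum>y<m. branchings Q (Suc y) t) + (?d - 1)" by simp
    \<comment> \<open>The induction hypothesis spares 1 for each of the \<open>?d\<close> good
      children; the root spends \<open>?d - 1\<close> and keeps 1. If \<open>?d = 0\<close>, that 1
      comes from \<open>max 1\<close>.\<close>
    moreover have "(\<Sum>t\<leftarrow>ts. \<Sum>y<m. branchings Q (Suc y) t) + ?d \<le> (\<Sum>t\<leftarrow>ts. pruned_leaves Q t)"
      unfolding d sum_list_addf[symmetric] using Node by (intro sum_list_mono) auto
    moreover have "(\<Sum>t\<leftarrow>ts. pruned_leaves Q t) = 0" if "?d = 0"
      using that by (simp add: sum_list_eq_0_iff filter_empty_conv pruned_leaves_eq_0)
    ultimately show ?thesis
      unfolding pruned_leaves.simps if_P[OF True] by (cases "?d = 0") linarith+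
  next
    case False
    then show ?thesis using branchings_eq_0[of Q "Node ts"] up by simp
  qed
qed

section \<open>Caterpillars\<close>

fun caterpillar :: "nat \<Rightarrow> nat \<Rightarrow> rtree \<Rightarrow> rtree" where
  "caterpillar 0 y B = B"
| "caterpillar (Suc x) y B = Node (caterpillar x y B # replicate y B)"

lemma num_leaves_caterpillar: "num_leaves (caterpillar x y B) = (x * y + 1) * num_leaves B"
  by (induction x) (simp_all add: num_leaves_Node sum_list_replicate algebra_simps)

lemma no_degree_one_caterpillar:
  "1 \<le> y \<Longrightarrow> no_degree_one B \<Longrightarrow> no_degree_one (caterpillar x y B)"
  by (induction x) (auto simp: no_degree_one_Node)

lemma spine_rank_child_le: "t \<in> set ts \<Longrightarrow> spine_rank Q y t \<le> spine_rank Q y (Node ts)"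
  by (simp add: trans_le_add1)

text \<open>The \<open>y + 1\<close> children of a spine node go into distinct child subtrees, all
  containing \<open>B\<close>, and child 0 carries the remaining spine. The conjunct
  \<open>minor B t\<close> makes the induction count child 0 as well.\<close>

lemma minor_caterpillar_imp_rank:
  "minor (caterpillar x y B) t \<Longrightarrow> minor B t \<and> x \<le> spine_rank (minor B) y t"
proof (induction x arbitrary: t)
  case (Suc x)
  from Suc.prems show ?case
  proof (induction "caterpillar (Suc x) y B" t rule: minor.induct)
    case (minor_child t ts)
    then have "minor B (Node ts)" by (blast intro: minor.minor_child)
    moreover have "Suc x \<le> spine_rank (minor B) y (Node ts)"
      using minor_child spine_rank_child_le by (meson order_trans)
    ultimately show ?case by blast
  next
    case (minor_node \<sigma> ss ts)
    then have ss: "ss = caterpillar x y B # replicate y B" by simp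
    have all: "minor B (ts ! \<sigma> i)" if "i < length ss" for i
      using minor_node.hyps(3)[OF that] Suc.IH that by (cases i) (auto simp: ss)
    have "\<sigma> ` {..<length ss} \<subseteq> {i. i < length ts \<and> minor B (ts ! i)}"
      using minor_node.hyps(2) all by auto
    then have "card {..<length ss} \<le> length (filter (minor B) ts)"
      unfolding length_filter_conv_card
      using minor_node.hyps(1)
      by (metis card_image card_mono finite_Collect_conjI finite_Collect_less_nat)
    then have "y < length (filter (minor B) ts)" by (simp add: ss)
    moreover have 0: "\<sigma> 0 < length ts" "x \<le> spine_rank (minor B) y (ts ! \<sigma> 0)" "minor B (ts ! \<sigma> 0)"
      using minor_node.hyps(2,3)[of 0] Suc.IH by (auto simp: ss)
    have "spine_rank (minor B) y (ts ! \<sigma> 0) \<le> Max (insert 0 (spine_rank (minor B) y ` set ts))"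
      using 0 by (intro Max_ge) auto
    with 0 have "x \<le> Max (insert 0 (spine_rank (minor B) y ` set ts))" by linarith
    moreover have "minor B (Node ts)"
      using 0 by (intro minor.minor_child[of "ts ! \<sigma> 0"]) auto
    ultimately show ?case by (simp del: Max_insert)
  qed
qed auto

text \<open>The sums are swapped because nodes are distinct over \<open>x\<close> only for fixed
  \<open>y\<close>.\<close>

lemma sum_pruned_leaves_caterpillar:
  "(\<Sum>x<k. \<Sum>y<m. pruned_leaves (minor (caterpillar (Suc x) (Suc y) B)) t)
    \<le> pruned_leaves (minor B) t"
proof -
  have "(\<Sum>x<k. \<Sum>y<m. pruned_leaves (minor (caterpillar (Suc x) (Suc y) B)) t)
      \<le> (\<Sum>x<k. \<Sum>y<m. pruned_leaves (\<lambda>t. Suc x \<le> spine_rank (minor B) (Suc y) t) t)"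
    using minor_caterpillar_imp_rank by (intro sum_mono pruned_leaves_mono) blast
  also have "\<dots> = (\<Sum>y<m. \<Sum>x<k. pruned_leaves (\<lambda>t. Suc x \<le> spine_rank (minor B) (Suc y) t) t)"
    by (rule sum.swap)
  also have "\<dots> \<le> (\<Sum>y<m. branchings (minor B) (Suc y) t)"
    by (intro sum_mono sum_pruned_leaves_rank)
  also have "\<dots> \<le> pruned_leaves (minor B) t"
    using sum_branchings[of "minor B" t m] minor_child by fastforce
  finally show ?thesis .
qed

section \<open>Partial sums and averaging\<close>

text \<open>For \<open>c > 1\<close> the terms are dominated by a product of two convergent series,
  so both infinite sums are limits and can be cut off, the outer one first.\<close>

lemma finite_double_sum_gt_1:
  fixes c :: real
  assumes "c > 1"
    and gt: "(\<Sum>x. \<Sum>y. (real (Suc x) * real (Suc y) + 1) powr (- c)) > 1"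
  obtains k m where "(\<Sum>x<k. \<Sum>y<m. (real (Suc x) * real (Suc y) + 1) powr (- c)) > 1"
proof -
  define p where "p x y = (real (Suc x) * real (Suc y) + 1) powr (- c)" for x y
  have zeta: "summable (\<lambda>y. real (Suc y) powr (- c))"
    using assms(1) summable_real_powr_iff[of "- c"] by (subst summable_Suc_iff) auto
  have p_le: "p x y \<le> real (Suc x) powr (- c) * real (Suc y) powr (- c)" for x y
    unfolding p_def using assms(1)
    by (subst powr_mult[symmetric]) (auto intro!: powr_mono2')
  have sum_p: "summable (p x)" for x
    by (rule summable_comparison_test'[OF summable_mult[OF zeta, of "real (Suc x) powr (- c)"], of 0])
      (use p_le in \<open>auto simp: p_def\<close>)
  have "suminf (p x) \<le> real (Suc x) powr (- c) * (\<Sum>y. real (Suc y) powr (- c))" for x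
    using suminf_le[OF p_le sum_p summable_mult[OF zeta]] suminf_mult[OF zeta] by simp
  moreover have "0 \<le> suminf (p x)" for x
    by (intro suminf_nonneg sum_p) (simp add: p_def)
  ultimately have "summable (\<lambda>x. suminf (p x))"
    by (intro summable_comparison_test'[OF summable_mult2[OF zeta], of 0]) auto
  then have "(\<lambda>k. \<Sum>x<k. suminf (p x)) \<longlonglongrightarrow> (\<Sum>x. suminf (p x))"
    by (rule summable_LIMSEQ)
  moreover have "(\<Sum>x. suminf (p x)) > 1" using gt unfolding p_def .
  ultimately have "\<forall>\<^sub>F k in sequentially. (\<Sum>x<k. suminf (p x)) > 1"
    by (rule order_tendstoD)
  then obtain k where k: "(\<Sum>x<k. suminf (p x)) > 1"
    by (auto simp: eventually_sequentially)
  have "(\<lambda>m. \<Sum>x<k. \<Sum>y<m. p x y) \<longlonglongrightarrow> (\<Sum>x<k. suminf (p x))"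
    by (intro tendsto_sum summable_LIMSEQ sum_p)
  from order_tendstoD(1)[OF this k] obtain m where "(\<Sum>x<k. \<Sum>y<m. p x y) > 1"
    by (auto simp: eventually_sequentially)
  then show thesis using that unfolding p_def by blast
qed

text \<open>If every caterpillar exceeded its weighted share of
  \<open>pruned_leaves (minor B) t\<close>, their total would exceed that number. Strictness comes
  from the negated claim, so the number may be 0.\<close>

lemma exists_sparse_caterpillar:
  fixes c :: real
  assumes gt: "(\<Sum>x<k. \<Sum>y<m. (real (Suc x) * real (Suc y) + 1) powr (- c)) > 1"
  shows "\<exists>x<k. \<exists>y<m. real (pruned_leaves (minor (caterpillar (Suc x) (Suc y) B)) t)
    \<le> real (pruned_leaves (minor B) t) * (real (Suc x) * real (Suc y) + 1) powr (- c)"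
proof (rule ccontr)
  let ?p = "\<lambda>x y. (real (Suc x) * real (Suc y) + 1) powr (- c)"
  let ?V = "real (pruned_leaves (minor B) t)"
  let ?W = "\<lambda>x y. real (pruned_leaves (minor (caterpillar (Suc x) (Suc y) B)) t)"
  assume "\<not> ?thesis"
  then have less: "?V * ?p x y < ?W x y" if "x < k" "y < m" for x y
    using that by (meson not_le)
  have km: "0 < k" "0 < m" using gt by (auto intro!: gr0I)
  have "?V \<le> ?V * (\<Sum>x<k. \<Sum>y<m. ?p x y)"
    using gt mult_left_mono[of 1 "\<Sum>x<k. \<Sum>y<m. ?p x y" ?V] by simp
  also have "\<dots> = (\<Sum>x<k. \<Sum>y<m. ?V * ?p x y)" by (simp only: sum_distrib_left)
  also have "\<dots> < (\<Sum>x<k. \<Sum>y<m. ?W x y)"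
    using km less by (intro sum_strict_mono) auto
  also have "\<dots> = real (\<Sum>x<k. \<Sum>y<m. pruned_leaves (minor (caterpillar (Suc x) (Suc y) B)) t)"
    by simp
  also have "\<dots> \<le> ?V" using sum_pruned_leaves_caterpillar of_nat_le_iff by blast
  finally show False by simp
qed

section \<open>Iteration and the lower bound\<close>

text \<open>By induction on \<open>n\<close>: \<open>B\<close> is kept until \<open>n\<close>
  reaches \<open>(k * m + 1) * num_leaves B\<close>, then replaced by a sparse caterpillar over
  \<open>B\<close>, larger by a factor between 2 and \<open>k * m + 1\<close>.\<close>

lemma exists_sparse_tree:
  fixes c :: real
  assumes gt: "(\<Sum>x<k. \<Sum>y<m. (real (Suc x) * real (Suc y) + 1) powr (- c)) > 1"
    and "1 \<le> n"
  shows "\<exists>B. no_degree_one B \<and> num_leaves B \<le> n \<and> n < (k * m + 1) * num_leaves B \<and>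
    real (pruned_leaves (minor B) T) * real (num_leaves B) powr c \<le> real (num_leaves T)"
  using \<open>1 \<le> n\<close>
proof (induction n rule: dec_induct)
  case base
  have "0 < k" "0 < m" using gt by (auto intro!: gr0I)
  \<comment> \<open>Every subtree contains a single leaf, so the bound starts with equality.\<close>
  moreover have "minor (Node []) = (\<lambda>_. True)" by auto
  ultimately show ?case
    by (intro exI[of _ "Node []"]) (simp add: no_degree_one_Node num_leaves_Node pruned_leaves_True)
next
  case (step n)
  let ?K = "k * m + 1"
  from step.IH obtain B where B: "no_degree_one B" "num_leaves B \<le> n" "n < ?K * num_leaves B"
    "real (pruned_leaves (minor B) T) * real (num_leaves B) powr c \<le> real (num_leaves T)" by blast
  show ?case
  proof (cases "Suc n < ?K * num_leaves B")
    case True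
    with B show ?thesis by (intro exI[of _ B]) simp
  next
    case False
    then have n: "Suc n = ?K * num_leaves B" using B by simp
    obtain x y where xy: "x < k" "y < m" and le:
      "real (pruned_leaves (minor (caterpillar (Suc x) (Suc y) B)) T)
        \<le> real (pruned_leaves (minor B) T) * (real (Suc x) * real (Suc y) + 1) powr (- c)"
      using exists_sparse_caterpillar[OF gt] by blast
    let ?C = "caterpillar (Suc x) (Suc y) B"
    let ?q = "Suc x * Suc y + 1"
    have C: "num_leaves ?C = ?q * num_leaves B" by (rule num_leaves_caterpillar)
    have q: "?q \<le> ?K" "2 \<le> ?q" using xy mult_le_mono[of "Suc x" k "Suc y" m] by auto
    have "num_leaves ?C \<le> Suc n" unfolding C n using q by (intro mult_le_mono) auto
    moreover have "Suc n < ?K * num_leaves ?C"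
    proof -
      have "1 * num_leaves B < ?q * num_leaves B"
        using q num_leaves_pos[of B] by (intro mult_strict_right_mono) linarith+
      then show ?thesis unfolding n C by (intro mult_strict_left_mono) auto
    qed
    \<comment> \<open>The weight \<open>?q powr (- c)\<close> cancels the growth of the leaf count
      to the power \<open>c\<close>.\<close>
    moreover have "real (pruned_leaves (minor ?C) T) * real (num_leaves ?C) powr c
        \<le> real (num_leaves T)"
    proof -
      have q_eq: "real (Suc x) * real (Suc y) + 1 = real ?q"
        by (simp only: of_nat_mult of_nat_add of_nat_1)
      have "real (pruned_leaves (minor ?C) T) * real (num_leaves ?C) powr c
          \<le> (real (pruned_leaves (minor B) T) * real ?q powr (- c)) * real (num_leaves ?C) powr c"
        using le unfolding q_eq by (intro mult_right_mono) auto
      also have "\<dots> = (real (pruned_leaves (minor B) T) * real ?q powr (- c)) *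
          (real ?q powr c * real (num_leaves B) powr c)"
        unfolding C of_nat_mult powr_mult ..
      also have "\<dots> = real (pruned_leaves (minor B) T) * real (num_leaves B) powr c"
        using q by (simp add: powr_minus field_simps del: of_nat_add of_nat_mult of_nat_Suc)
      finally show ?thesis using B(4) by (rule order_trans)
    qed
    ultimately show ?thesis using no_degree_one_caterpillar[of "Suc y" B "Suc x"] B(1)
      by (intro exI[of _ ?C]) simp
  qed
qed

text \<open>A tree with too few leaves gets a new root and leaf siblings up to \<open>n\<close>. At
  least one is added, so the root does not have degree 1.\<close>

lemma minor_of_universal:
  assumes univ: "\<And>t. num_leaves t = n \<Longrightarrow> no_degree_one t \<Longrightarrow> top_minor t T"
    and B: "no_degree_one B" "num_leaves B \<le> n"
  shows "minor B T"
proof (cases "num_leaves B = n")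
  case True
  then show ?thesis using univ B top_minor_imp_minor by blast
next
  case False
  let ?B = "Node (B # replicate (n - num_leaves B) (Node []))"
  have "num_leaves ?B = n" using B by (simp add: num_leaves_Node sum_list_replicate)
  moreover have "no_degree_one ?B" using B False by (auto simp: no_degree_one_Node)
  ultimately have "minor ?B T" using univ top_minor_imp_minor by blast
  then show ?thesis using minor_subtree by auto
qed

theorem theorem8:
  fixes c :: real
  assumes "c > 1"
    and "(\<Sum>x. \<Sum>y. (real (Suc x) * real (Suc y) + 1) powr (- c)) > 1"
  shows "\<exists>a > 0. \<forall>n \<ge> 1. real (univ_leaves n) \<ge> a * real n powr c"
proof -
  obtain k m where gt: "(\<Sum>x<k. \<Sum>y<m. (real (Suc x) * real (Suc y) + 1) powr (- c)) > 1"
    using finite_double_sum_gt_1[OF assms] .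
  let ?K = "real (k * m + 1)"
  \<comment> \<open>The constant is \<open>?K powr (- c)\<close>, since the sparse tree has more
    than \<open>n / ?K\<close> leaves.\<close>
  have "?K powr (- c) * real n powr c \<le> real (univ_leaves n)" if n: "1 \<le> n" for n
  proof -
    obtain T where T: "num_leaves T = univ_leaves n"
      and univ: "\<And>t. num_leaves t = n \<Longrightarrow> no_degree_one t \<Longrightarrow> top_minor t T"
      using univ_leaves_attained[of n] by blast
    obtain B where B: "no_degree_one B" "num_leaves B \<le> n" "n < (k * m + 1) * num_leaves B"
      and le: "real (pruned_leaves (minor B) T) * real (num_leaves B) powr c \<le> real (num_leaves T)"
      using exists_sparse_tree[OF gt n] by blast
    have "minor B T" using minor_of_universal[OF univ B(1,2)] .
    then have "1 \<le> pruned_leaves (minor B) T" by (rule pruned_leaves_pos)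
    then have "1 * real (num_leaves B) powr c
        \<le> real (pruned_leaves (minor B) T) * real (num_leaves B) powr c"
      by (intro mult_right_mono) auto
    with le T have "real (num_leaves B) powr c \<le> real (univ_leaves n)" by simp
    moreover have "real n powr c \<le> (?K * real (num_leaves B)) powr c"
    proof (rule powr_mono2)
      show "real n \<le> ?K * real (num_leaves B)"
        using B(3) by (metis less_imp_le of_nat_le_iff of_nat_mult)
    qed (use assms in auto)
    moreover have "(?K * real (num_leaves B)) powr c = ?K powr c * real (num_leaves B) powr c"
      by (rule powr_mult)
    moreover have "?K powr (- c) * (?K powr c * z) = z" for z
      by (simp add: powr_minus field_simps del: of_nat_add of_nat_mult of_nat_Suc)
    ultimately show ?thesis
      by (metis mult_left_mono order_trans powr_ge_zero)
  qed
  moreover have "0 < ?K powr (- c)" by (simp del: of_nat_add of_nat_mult)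
  ultimately show ?thesis by blast
qed

end
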